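(* Let $\Pi$ be a non-negative function on the set of real symmetric positive definite matrices of order $q$, and define $\Pi_s(\Sigma)=\Pi\{V(\Sigma)\}$, where $V(\Sigma)=\Sigma/\det(\Sigma)^{1/q}$. (i) If $\Pi(\Sigma)$ is g-convex, then $\Pi_s(\Sigma)$ is also g-convex. (ii) If $\Pi(\Sigma)$ is convex in $\log\Sigma$, then $\Pi_s(\Sigma)$ is also convex in $\log\Sigma$.
   Context: $\Sigma>0$ means $\Sigma$ is a real symmetric positive definite matrix of order $q$. The geodesic path from $\Sigma_0>0$ to $\Sigma_1>0$ is $\Sigma_t=\Sigma_0^{1/2}\{\Sigma_0^{-1/2}\Sigma_1\Sigma_0^{-1/2}\}^t\Sigma_0^{1/2}$, $0\le t\le 1$. A function $F$ on $\Sigma>0$ is g-convex if $F(\Sigma_t)\le(1-t)F(\Sigma_0)+tF(\Sigma_1)$ for all $\Sigma_0,\Sigma_1>0$ and $0<t<1$. $F$ is convex in $\log\Sigma$ if $A\mapsto F(e^A)$ is convex on the vector space of real symmetric matrices of order $q$, where $e^A$ is the matrix exponential. $V(\Sigma)$ is called the shape matrix of $\Sigma$. *)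

theory Defs
  imports "HOL-Analysis.Analysis"
begin

definition pos_def_mat :: "real^'n^'n \<Rightarrow> bool" where
  "pos_def_mat S \<longleftrightarrow> transpose S = S \<and> (\<forall>x. x \<noteq> 0 \<longrightarrow> 0 < x \<bullet> (S *v x))"

definition diag_mat :: "real^'n \<Rightarrow> real^'n^'n" where
  "diag_mat d = (\<chi> i j. if i = j then d $ i else 0)"

text \<open>Real powers through the spectral decomposition: if \<open>S = Q diag(d) Q\<^sup>T\<close> with \<open>Q\<close> orthogonal
  and \<open>d > 0\<close>, then \<open>S\<^sup>t = Q diag(d\<^sup>t) Q\<^sup>T\<close>. The value does not depend on the decomposition.
  It is only meaningful for positive definite \<open>S\<close>.\<close>

definition mat_powr :: "real^'n^'n \<Rightarrow> real \<Rightarrow> real^'n^'n" where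
  "mat_powr S t = (THE B. \<exists>Q d. orthogonal_matrix Q \<and> (\<forall>i. 0 < d $ i) \<and>
      S = Q ** diag_mat d ** transpose Q \<and>
      B = Q ** diag_mat (\<chi> i. d $ i powr t) ** transpose Q)"

text \<open>The type class operations \<open>*\<close> and \<open>^\<close> on \<open>real^'n^'n\<close> are entrywise, hence the explicit
  iteration of the matrix product.\<close>

definition mat_exp :: "real^'n^'n \<Rightarrow> real^'n^'n" where
  "mat_exp A = (\<Sum>k. (1 / fact k) *\<^sub>R (((\<lambda>B. A ** B) ^^ k) (mat 1)))"

definition geodesic :: "real^'n^'n \<Rightarrow> real^'n^'n \<Rightarrow> real \<Rightarrow> real^'n^'n" where
  "geodesic S0 S1 t =
     mat_powr S0 (1/2)
       ** mat_powr (mat_powr S0 (-1/2) ** S1 ** mat_powr S0 (-1/2)) t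
       ** mat_powr S0 (1/2)"

definition g_convex :: "(real^'n^'n \<Rightarrow> real) \<Rightarrow> bool" where
  "g_convex F \<longleftrightarrow> (\<forall>S0 S1 t. pos_def_mat S0 \<and> pos_def_mat S1 \<and> 0 < t \<and> t < 1 \<longrightarrow>
     F (geodesic S0 S1 t) \<le> (1 - t) * F S0 + t * F S1)"

definition convex_in_log :: "(real^'n^'n \<Rightarrow> real) \<Rightarrow> bool" where
  "convex_in_log F \<longleftrightarrow> convex_on {A. transpose A = A} (\<lambda>A. F (mat_exp A))"

definition shape_matrix :: "real^'n^'n \<Rightarrow> real^'n^'n" where
  "shape_matrix S = (1 / det S powr (1 / real CARD('n))) *\<^sub>R S"

definition shape_version :: "(real^'n^'n \<Rightarrow> real) \<Rightarrow> real^'n^'n \<Rightarrow> real" where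
  "shape_version P S = P (shape_matrix S)"

end

theory Submission
  imports Defs
begin

text \<open>
  Both claims hold because passing to the shape matrix is an affine operation for the relevant
  convex structure, and composing a convex function with an affine map keeps it convex.

  For geodesics: the powers of a positive definite matrix are homogeneous, so rescaling the end
  points by \<open>a, b > 0\<close> rescales the geodesic at time \<open>t\<close> by \<open>a\<^sup>1\<^sup>-\<^sup>t b\<^sup>t\<close>
  (\<open>geodesic_scaleR\<close>). The determinant along a geodesic is the corresponding weighted
  geometric mean of the determinants at the ends (\<open>det_geodesic\<close>). The two scalars match, and
  therefore normalising the geodesic gives the geodesic between the normalised end points
  (\<open>shape_matrix_geodesic\<close>). The convexity inequality for \<open>P\<close> at these end points is
  the one for the shape version of \<open>P\<close>.

  For logarithms: \<open>det (exp A) = exp (trace A)\<close>, so normalising \<open>exp A\<close> amounts to replacing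
  \<open>A\<close> by its trace-free part \<open>A - (trace A / q) I\<close> (\<open>shape_matrix_mat_exp\<close>). This is a linear
  map from the symmetric matrices to themselves.

  Powers and exponentials are computed through the spectral theorem
  (\<open>symmetric_spectral_decomposition\<close>): in an eigenbasis they act on the eigenvalues alone.
  A real power is defined by a unique description over all spectral decompositions, so it must be
  shown not to depend on the decomposition (\<open>spectral_function_unique\<close>).
\<close>

section \<open>The spectral theorem for real symmetric matrices\<close>

lemma symmetric_inner_matrix_vector:
  fixes A :: "real^'n^'n"
  assumes "transpose A = A"
  shows "x \<bullet> (A *v y) = (A *v x) \<bullet> y"
  by (metis assms dot_lmul_matrix transpose_matrix_vector)

text \<open>First-order condition at a maximum: near \<open>t = 0\<close> the linear term dominates the quadratic one, and
  its sign changes with that of \<open>t\<close>.\<close>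

lemma linear_coefficient_zero:
  fixes a b :: real
  assumes "\<And>t. 2 * t * a + t\<^sup>2 * b \<le> 0"
  shows "a = 0"
proof (rule ccontr)
  assume "a \<noteq> 0"
  define c where "c = \<bar>b\<bar> + 1"
  have c: "0 < c" "- c < b" by (auto simp: c_def)
  \<comment> \<open>small enough that the quadratic term cannot outweigh the linear one\<close>
  define t where "t = a / c"
  have "2 * t * a + t\<^sup>2 * b = (a\<^sup>2 / c) * (2 + b / c)"
    unfolding t_def using c by (simp add: field_simps power2_eq_square)
  moreover have "2 + b / c > 0" using c by (simp add: field_simps)
  moreover have "a\<^sup>2 / c > 0" using \<open>a \<noteq> 0\<close> c by simp
  ultimately have "2 * t * a + t\<^sup>2 * b > 0"
    by (simp only: mult_pos_pos)
  with assms[of t] show False by simp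
qed

text \<open>The maximiser \<open>v\<close> of the Rayleigh quotient over the unit sphere of the invariant subspace is an
  eigenvector: perturbing \<open>v\<close> in a direction \<open>w\<close> of the subspace gives
  \<open>w \<bullet> (A v - \<mu> v) = 0\<close>, and by invariance \<open>w = A v - \<mu> v\<close> is itself such a direction.\<close>

lemma symmetric_eigenvector_in_subspace:
  fixes A :: "real^'n^'n"
  assumes sym: "transpose A = A" and sub: "subspace S"
    and inv: "\<And>x. x \<in> S \<Longrightarrow> A *v x \<in> S" and x0: "x0 \<in> S" "x0 \<noteq> 0"
  obtains v \<mu> where "v \<in> S" "norm v = 1" "A *v v = \<mu> *\<^sub>R v"
proof -
  let ?K = "sphere 0 1 \<inter> S"
  have "compact ?K"
    by (intro compact_Int_closed compact_sphere closed_subspace sub)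
  moreover have "x0 /\<^sub>R norm x0 \<in> ?K"
    using x0 sub by (auto simp: subspace_scale)
  moreover have "continuous_on ?K (\<lambda>x. x \<bullet> (A *v x))"
    by (intro continuous_intros linear_continuous_on matrix_vector_mul_bounded_linear)
  ultimately obtain v where v: "v \<in> ?K" and max: "\<And>x. x \<in> ?K \<Longrightarrow> x \<bullet> (A *v x) \<le> v \<bullet> (A *v v)"
    using continuous_attains_sup[of ?K "\<lambda>x. x \<bullet> (A *v x)"] by blast
  define \<mu> where "\<mu> = v \<bullet> (A *v v)"
  have vS: "v \<in> S" and nv: "norm v = 1" using v by auto
  have vv: "v \<bullet> v = 1" using nv by (simp add: norm_eq_1)
  have bound: "x \<bullet> (A *v x) \<le> \<mu> * (x \<bullet> x)" if "x \<in> S" for x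
  proof (cases "x = 0")
    case False
    have "x /\<^sub>R norm x \<in> ?K" using that False sub by (auto simp: subspace_scale)
    from max[OF this] have "(x \<bullet> (A *v x)) / (norm x)\<^sup>2 \<le> \<mu>"
      unfolding \<mu>_def by (simp add: matrix_vector_mult_scaleR power2_eq_square divide_inverse mult_ac)
    then show ?thesis using False
      by (simp add: divide_simps power2_norm_eq_inner split: if_splits)
  qed auto
  define w where "w = A *v v - \<mu> *\<^sub>R v"
  have wS: "w \<in> S" unfolding w_def by (intro subspace_diff subspace_scale sub inv vS)
  have "w \<bullet> w = 0"
  proof (rule linear_coefficient_zero)
    fix t
    have *: "v + t *\<^sub>R w \<in> S" by (intro subspace_add subspace_scale sub vS wS)
    have "v \<bullet> (A *v w) = w \<bullet> (A *v v)"
      using symmetric_inner_matrix_vector[OF sym, of v w] by (simp add: inner_commute)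
    then have "(v + t *\<^sub>R w) \<bullet> (A *v (v + t *\<^sub>R w)) - \<mu> * ((v + t *\<^sub>R w) \<bullet> (v + t *\<^sub>R w)) =
        2 * t * (w \<bullet> (A *v v) - \<mu> * (w \<bullet> v)) + t\<^sup>2 * (w \<bullet> (A *v w) - \<mu> * (w \<bullet> w))"
      using vv by (simp add: matrix_vector_mult_scaleR algebra_simps inner_commute[of v w]
        power2_eq_square matrix_vector_right_distrib \<mu>_def[symmetric])
    moreover have "w \<bullet> (A *v v) - \<mu> * (w \<bullet> v) = w \<bullet> w"
      by (simp add: w_def inner_diff_right)
    ultimately show "2 * t * (w \<bullet> w) + t\<^sup>2 * (w \<bullet> (A *v w) - \<mu> * (w \<bullet> w)) \<le> 0"
      using bound[OF *] by simp
  qed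
  then have "A *v v = \<mu> *\<^sub>R v" by (simp add: w_def)
  with vS nv show ?thesis by (rule that)
qed

text \<open>As long as there are fewer than \<open>n\<close> eigenvectors, their orthogonal complement is nonzero. It is
  invariant because \<open>A\<close> is symmetric and maps each chosen vector to a multiple of itself, so it
  contains another eigenvector.\<close>

lemma symmetric_orthonormal_eigenvectors:
  fixes A :: "real^'n^'n"
  assumes sym: "transpose A = A" and "k \<le> CARD('n)"
  shows "\<exists>B. finite B \<and> card B = k \<and> pairwise orthogonal B \<and>
           (\<forall>b\<in>B. norm b = 1 \<and> (\<exists>\<mu>. A *v b = \<mu> *\<^sub>R b))"
  using assms(2)
proof (induction k)
  case 0
  show ?case by (rule exI[of _ "{}"]) simp
next
  case (Suc k)
  then obtain B where B: "finite B" "card B = k" "pairwise orthogonal B"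
    and eig: "\<And>b. b \<in> B \<Longrightarrow> norm b = 1 \<and> (\<exists>\<mu>. A *v b = \<mu> *\<^sub>R b)"
    by auto
  define S where "S = {x. \<forall>b\<in>B. orthogonal b x}"
  have sub: "subspace S"
    unfolding S_def subspace_def by (auto simp: orthogonal_clauses)
  have inv: "A *v x \<in> S" if "x \<in> S" for x
    unfolding S_def
  proof (intro CollectI ballI)
    fix b assume b: "b \<in> B"
    then obtain \<mu> where "A *v b = \<mu> *\<^sub>R b" using eig by blast
    moreover have "b \<bullet> x = 0" using that b by (simp add: S_def orthogonal_def)
    ultimately show "orthogonal b (A *v x)"
      by (simp add: orthogonal_def symmetric_inner_matrix_vector[OF sym])
  qed
  have "dim B < DIM(real^'n)"
    using dim_le_card'[OF B(1)] B(2) Suc.prems by simp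
  then obtain x0 where "x0 \<noteq> 0" "\<And>y. y \<in> span B \<Longrightarrow> orthogonal x0 y"
    using orthogonal_to_subspace_exists[of B] by blast
  then have "x0 \<in> S" "x0 \<noteq> 0" by (auto simp: S_def span_base orthogonal_commute)
  then obtain v \<mu> where v: "v \<in> S" "norm v = 1" "A *v v = \<mu> *\<^sub>R v"
    using symmetric_eigenvector_in_subspace[OF sym sub inv] by metis
  have "v \<notin> B"
    using v by (force simp: S_def orthogonal_def)
  then show ?case
    using B eig v by (intro exI[of _ "insert v B"])
      (auto simp: pairwise_insert S_def orthogonal_commute)
qed

lemma orthogonal_matrix_cancel:
  fixes Q M :: "real^'n^'n"
  assumes "orthogonal_matrix Q"
  shows "Q ** (transpose Q ** M) = M" "transpose Q ** (Q ** M) = M"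
  using assms by (simp_all add: matrix_mul_assoc orthogonal_matrix_def)

definition spectral :: "real^'n^'n \<Rightarrow> real^'n \<Rightarrow> real^'n^'n" where
  "spectral Q d = Q ** diag_mat d ** transpose Q"

lemma diag_mat_mult_left: "(diag_mat d ** M) $ i $ j = d $ i * M $ i $ j"
  by (simp add: diag_mat_def matrix_matrix_mult_def if_distrib[of "\<lambda>x. x * _"] cong: if_cong)

lemma diag_mat_mult_right: "(M ** diag_mat d) $ i $ j = M $ i $ j * d $ j"
  by (simp add: diag_mat_def matrix_matrix_mult_def if_distrib[of "\<lambda>x. _ * x"] cong: if_cong)

lemma transpose_diag_mat [simp]: "transpose (diag_mat d) = diag_mat d"
  by (auto simp: diag_mat_def transpose_def vec_eq_iff)

text \<open>The columns of \<open>Q\<close> are an orthonormal basis of eigenvectors; then \<open>A Q = Q diag d\<close> says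
  columnwise that they are eigenvectors.\<close>

theorem symmetric_spectral_decomposition:
  fixes A :: "real^'n^'n"
  assumes sym: "transpose A = A"
  obtains Q d where "orthogonal_matrix Q" "A = spectral Q d"
proof -
  obtain B where B: "finite B" "card B = CARD('n)" "pairwise orthogonal B"
    and eig: "\<And>b. b \<in> B \<Longrightarrow> norm b = 1 \<and> (\<exists>\<mu>. A *v b = \<mu> *\<^sub>R b)"
    using symmetric_orthonormal_eigenvectors[OF sym order_refl] by auto
  obtain f where f: "bij_betw f (UNIV::'n set) B"
    using B finite_same_card_bij[of "UNIV::'n set" B] by auto
  have fB: "f j \<in> B" for j using f by (auto simp: bij_betw_def)
  have "\<forall>j. \<exists>\<mu>. A *v f j = \<mu> *\<^sub>R f j" using eig fB by blast
  then obtain m where m: "\<And>j. A *v f j = m j *\<^sub>R f j" using choice[of "\<lambda>j \<mu>. A *v f j = \<mu> *\<^sub>R f j"] by blast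
  define Q :: "real^'n^'n" where "Q = (\<chi> i j. f j $ i)"
  define d :: "real^'n" where "d = (\<chi> j. m j)"
  have col: "column j Q = f j" for j by (simp add: Q_def column_def)
  have "f i \<noteq> f j" if "i \<noteq> j" for i j
    using f that by (auto simp: bij_betw_def inj_on_def)
  then have Q: "orthogonal_matrix Q"
    unfolding orthogonal_matrix_orthonormal_columns col
    using B(3) fB eig by (auto simp: pairwise_def)
  have "A ** Q = Q ** diag_mat d"
  proof -
    have "(A ** Q) $ i $ j = (A *v f j) $ i" for i j
      by (simp add: matrix_matrix_mult_def matrix_vector_mult_def Q_def)
    then show ?thesis
      unfolding vec_eq_iff diag_mat_mult_right by (simp add: m Q_def d_def)
  qed
  then have "spectral Q d = A ** Q ** transpose Q" by (simp add: spectral_def)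
  also have "\<dots> = A" using Q by (simp add: orthogonal_matrix_def flip: matrix_mul_assoc)
  finally have "A = spectral Q d" ..
  with Q show ?thesis by (rule that)
qed

section \<open>Calculus in a fixed eigenbasis\<close>

lemma spectral_mult:
  assumes "orthogonal_matrix Q"
  shows "spectral Q d ** spectral Q e = spectral Q (\<chi> i. d $ i * e $ i)"
proof -
  have "diag_mat d ** diag_mat e = diag_mat (\<chi> i. d $ i * e $ i)"
    by (simp add: vec_eq_iff diag_mat_mult_left) (simp add: diag_mat_def)
  then have "Q ** (diag_mat d ** (diag_mat e ** transpose Q)) =
      Q ** (diag_mat (\<chi> i. d $ i * e $ i) ** transpose Q)"
    by (simp add: matrix_mul_assoc)
  then show ?thesis
    by (simp add: spectral_def orthogonal_matrix_cancel[OF assms] flip: matrix_mul_assoc)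
qed

lemma spectral_one:
  fixes Q :: "real^'n^'n"
  assumes "orthogonal_matrix Q"
  shows "spectral Q (\<chi> i. 1) = mat 1"
proof -
  have "diag_mat (\<chi> i. 1) = (mat 1 :: real^'n^'n)"
    by (simp add: vec_eq_iff diag_mat_def mat_def)
  then show ?thesis using assms by (simp add: spectral_def orthogonal_matrix_def)
qed

lemma transpose_spectral [simp]: "transpose (spectral Q d) = spectral Q d"
  by (simp add: spectral_def matrix_transpose_mul matrix_mul_assoc)

lemma linear_spectral: "linear (spectral Q)"
  by (rule linearI)
    (simp_all add: spectral_def vec_eq_iff matrix_matrix_mult_def diag_mat_def sum.distrib sum_distrib_left
      distrib_left distrib_right if_distrib[of "\<lambda>x. _ * x"] mult_ac cong: if_cong)

lemma spectral_scaleR: "spectral Q (c *\<^sub>R d) = c *\<^sub>R spectral Q d"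
  by (rule linear_scale[OF linear_spectral])

lemma det_spectral:
  assumes "orthogonal_matrix Q"
  shows "det (spectral Q d) = (\<Prod>i\<in>UNIV. d $ i)"
proof -
  have "det Q * det Q = 1"
    using det_orthogonal_matrix[OF assms] by auto
  moreover have "det (diag_mat d) = (\<Prod>i\<in>UNIV. d $ i)"
    by (subst det_diagonal) (auto simp: diag_mat_def)
  ultimately show ?thesis
    by (simp add: spectral_def det_mul mult_ac)
qed

lemma trace_spectral:
  assumes "orthogonal_matrix Q"
  shows "trace (spectral Q d) = (\<Sum>i\<in>UNIV. d $ i)"
proof -
  have "trace (spectral Q d) = trace (transpose Q ** (Q ** diag_mat d))"
    unfolding spectral_def by (rule trace_mul_sym)
  also have "transpose Q ** (Q ** diag_mat d) = diag_mat d"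
    using assms by (simp add: matrix_mul_assoc orthogonal_matrix_def)
  finally show ?thesis by (simp add: trace_def diag_mat_def)
qed

text \<open>In the coordinates \<open>Q\<^sup>T x\<close> the quadratic form is the weighted sum of squares
  \<open>\<Sum> d\<^sub>i (Q\<^sup>T x)\<^sub>i\<^sup>2\<close>.\<close>

lemma pos_def_spectral_iff:
  assumes "orthogonal_matrix Q"
  shows "pos_def_mat (spectral Q d) \<longleftrightarrow> (\<forall>i. 0 < d $ i)"
proof -
  have quad: "x \<bullet> (spectral Q d *v x) = (\<Sum>i\<in>UNIV. d $ i * ((transpose Q *v x) $ i)\<^sup>2)" for x
  proof -
    have "x \<bullet> (spectral Q d *v x) = (transpose Q *v x) \<bullet> (diag_mat d *v (transpose Q *v x))"
      by (simp add: spectral_def dot_lmul_matrix flip: matrix_vector_mul_assoc)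
    also have "\<dots> = (\<Sum>i\<in>UNIV. d $ i * ((transpose Q *v x) $ i)\<^sup>2)"
      by (simp add: inner_vec_def matrix_vector_mult_def diag_mat_def power2_eq_square
        if_distrib[of "\<lambda>x. x * _"] mult_ac cong: if_cong)
    finally show ?thesis .
  qed
  have QQ: "transpose Q *v (Q *v x) = x" "Q *v (transpose Q *v x) = x" for x
    using assms by (simp_all only: matrix_vector_mul_assoc matrix_vector_mul_lid orthogonal_matrix_def)
  show ?thesis
  proof
    assume pd: "pos_def_mat (spectral Q d)"
    show "\<forall>i. 0 < d $ i"
    proof
      fix i
      let ?x = "Q *v axis i 1"
      have "?x \<noteq> 0" using QQ(1)[of "axis i 1"] by auto
      then have "0 < ?x \<bullet> (spectral Q d *v ?x)" using pd by (simp add: pos_def_mat_def)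
      also have "\<dots> = (\<Sum>k\<in>UNIV. if k = i then d $ i else 0)"
        unfolding quad QQ by (rule sum.cong) (auto simp: axis_def)
      finally show "0 < d $ i" by simp
    qed
  next
    assume pos: "\<forall>i. 0 < d $ i"
    have "0 < x \<bullet> (spectral Q d *v x)" if "x \<noteq> 0" for x
    proof -
      have "transpose Q *v x \<noteq> 0" using QQ(2)[of x] that by auto
      then obtain i where "(transpose Q *v x) $ i \<noteq> 0" by (auto simp: vec_eq_iff)
      then show ?thesis
        unfolding quad using pos by (intro sum_pos2[of _ i]) (auto simp: less_imp_le)
    qed
    then show "pos_def_mat (spectral Q d)" by (simp add: pos_def_mat_def)
  qed
qed

lemma pos_def_spectral_decomposition:
  assumes "pos_def_mat S"
  obtains Q d where "orthogonal_matrix Q" "\<And>i. 0 < d $ i" "S = spectral Q d"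
proof -
  obtain Q d where "orthogonal_matrix Q" "S = spectral Q d"
    using symmetric_spectral_decomposition[of S] assms by (auto simp: pos_def_mat_def)
  then show ?thesis using that pos_def_spectral_iff assms by blast
qed

section \<open>Real powers\<close>

text \<open>The change of basis \<open>M = R\<^sup>T Q\<close> satisfies \<open>M\<^sub>i\<^sub>j d\<^sub>j = e\<^sub>i M\<^sub>i\<^sub>j\<close>, so \<open>M\<^sub>i\<^sub>j\<close> can be nonzero only
  where \<open>d\<^sub>j = e\<^sub>i\<close>. Hence \<open>M\<close> also intertwines the diagonal matrices with entries
  \<open>f d\<^sub>j\<close> and \<open>f e\<^sub>i\<close>.\<close>

lemma spectral_function_unique:
  assumes Q: "orthogonal_matrix Q" and R: "orthogonal_matrix R"
    and eq: "spectral Q d = spectral R e"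
  shows "spectral Q (\<chi> i. f (d $ i)) = spectral R (\<chi> i. f (e $ i))"
proof -
  define M where "M = transpose R ** Q"
  have RM: "R ** M = Q"
    by (simp add: M_def orthogonal_matrix_cancel[OF R])
  have MQ: "M ** transpose Q = transpose R"
    using Q by (simp add: M_def orthogonal_matrix_def flip: matrix_mul_assoc)
  have "M ** diag_mat d = transpose R ** spectral Q d ** Q"
    using Q by (simp add: M_def spectral_def orthogonal_matrix_def flip: matrix_mul_assoc)
  also have "\<dots> = transpose R ** spectral R e ** Q" by (simp only: eq)
  also have "\<dots> = diag_mat e ** M"
    by (simp add: M_def spectral_def orthogonal_matrix_cancel[OF R] flip: matrix_mul_assoc)
  finally have "M $ i $ j * d $ j = e $ i * M $ i $ j" for i j
    by (metis diag_mat_mult_left diag_mat_mult_right)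
  then have "M $ i $ j = 0 \<or> d $ j = e $ i" for i j
    by (metis mult.commute mult_cancel_left)
  then have "M $ i $ j * f (d $ j) = f (e $ i) * M $ i $ j" for i j
    by (metis mult.commute mult_zero_left)
  then have "M ** diag_mat (\<chi> i. f (d $ i)) = diag_mat (\<chi> i. f (e $ i)) ** M"
    by (simp add: vec_eq_iff diag_mat_mult_left diag_mat_mult_right)
  then have "R ** (M ** diag_mat (\<chi> i. f (d $ i))) ** transpose Q =
      R ** (diag_mat (\<chi> i. f (e $ i)) ** M) ** transpose Q"
    by simp
  then show ?thesis
    by (simp add: spectral_def RM matrix_mul_assoc) (simp add: MQ flip: matrix_mul_assoc)
qed

lemma mat_powr_spectral:
  assumes "orthogonal_matrix Q" "\<And>i. 0 < d $ i"
  shows "mat_powr (spectral Q d) t = spectral Q (\<chi> i. d $ i powr t)"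
  unfolding mat_powr_def
proof (rule the_equality)
  show "\<exists>R e. orthogonal_matrix R \<and> (\<forall>i. 0 < e $ i) \<and>
      spectral Q d = R ** diag_mat e ** transpose R \<and>
      spectral Q (\<chi> i. d $ i powr t) = R ** diag_mat (\<chi> i. e $ i powr t) ** transpose R"
    using assms by (intro exI[of _ Q] exI[of _ d]) (simp add: spectral_def)
next
  fix B
  assume "\<exists>R e. orthogonal_matrix R \<and> (\<forall>i. 0 < e $ i) \<and>
      spectral Q d = R ** diag_mat e ** transpose R \<and>
      B = R ** diag_mat (\<chi> i. e $ i powr t) ** transpose R"
  then obtain R e where "orthogonal_matrix R" "spectral Q d = spectral R e"
    "B = spectral R (\<chi> i. e $ i powr t)"
    by (auto simp: spectral_def)
  then show "B = spectral Q (\<chi> i. d $ i powr t)"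
    using spectral_function_unique[OF assms(1), where f = "\<lambda>x. x powr t"] by metis
qed

lemma pos_def_mat_powr:
  assumes "pos_def_mat S"
  shows "pos_def_mat (mat_powr S t)"
proof -
  obtain Q d where "orthogonal_matrix Q" "\<And>i. 0 < d $ i" "S = spectral Q d"
    using pos_def_spectral_decomposition[OF assms] by blast
  then show ?thesis by (simp add: mat_powr_spectral pos_def_spectral_iff order_less_imp_not_eq2)
qed

lemma pos_def_det_pos:
  assumes "pos_def_mat S"
  shows "0 < det S"
proof -
  obtain Q d where "orthogonal_matrix Q" "\<And>i. 0 < d $ i" "S = spectral Q d"
    using pos_def_spectral_decomposition[OF assms] by blast
  then show ?thesis by (simp add: det_spectral prod_pos)
qed

lemma det_mat_powr:
  assumes "pos_def_mat S"
  shows "det (mat_powr S t) = det S powr t"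
proof -
  obtain Q d where "orthogonal_matrix Q" "\<And>i. 0 < d $ i" "S = spectral Q d"
    using pos_def_spectral_decomposition[OF assms] by blast
  then show ?thesis by (simp add: mat_powr_spectral det_spectral prod_powr_distrib less_imp_le)
qed

lemma pos_def_scaleR:
  assumes "pos_def_mat S" "0 < c"
  shows "pos_def_mat (c *\<^sub>R S)"
  using assms by (simp add: pos_def_mat_def transpose_scalar scaleR_matrix_vector_assoc[symmetric])

lemma mat_powr_scaleR:
  assumes "pos_def_mat S" and c: "0 < c"
  shows "mat_powr (c *\<^sub>R S) t = c powr t *\<^sub>R mat_powr S t"
proof -
  obtain Q d where Q: "orthogonal_matrix Q" and d: "\<And>i. 0 < d $ i" and S: "S = spectral Q d"
    using pos_def_spectral_decomposition[OF assms(1)] by blast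
  have "mat_powr (c *\<^sub>R S) t = spectral Q (\<chi> i. (c *\<^sub>R d) $ i powr t)"
    unfolding S spectral_scaleR[symmetric] using c d by (intro mat_powr_spectral Q) simp
  also have "(\<chi> i. (c *\<^sub>R d) $ i powr t) = c powr t *\<^sub>R (\<chi> i. d $ i powr t)"
    using c d by (simp add: vec_eq_iff powr_mult less_imp_le)
  finally show ?thesis by (simp add: S spectral_scaleR mat_powr_spectral Q d)
qed

lemma pos_def_congruence:
  assumes M: "pos_def_mat M" and S: "pos_def_mat S"
  shows "pos_def_mat (M ** S ** M)"
proof -
  have "0 < x \<bullet> ((M ** S ** M) *v x)" if "x \<noteq> 0" for x
  proof -
    have "M *v x \<noteq> 0" using M that by (force simp: pos_def_mat_def)
    then have "0 < (M *v x) \<bullet> (S *v (M *v x))" using S by (simp add: pos_def_mat_def)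
    also have "\<dots> = x \<bullet> ((M ** S ** M) *v x)"
      using M symmetric_inner_matrix_vector[of M x]
      by (simp add: pos_def_mat_def matrix_vector_mul_assoc[symmetric])
    finally show ?thesis .
  qed
  then show ?thesis
    using M S by (simp add: pos_def_mat_def matrix_transpose_mul matrix_mul_assoc)
qed

section \<open>Normalisation and geodesics\<close>

text \<open>The two outer factors contribute \<open>det S0\<close> in total, and the inner \<open>S0\<close>-factors, which have total
  exponent \<open>-1\<close>, contribute \<open>(det S0)\<^sup>-\<^sup>t\<close>.\<close>

lemma det_geodesic:
  assumes S0: "pos_def_mat S0" and S1: "pos_def_mat S1"
  shows "det (geodesic S0 S1 t) = det S0 powr (1 - t) * det S1 powr t"
proof -
  have pos: "0 < det S0" "0 < det S1" using S0 S1 by (auto intro: pos_def_det_pos)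
  have mid: "pos_def_mat (mat_powr S0 (-1/2) ** S1 ** mat_powr S0 (-1/2))"
    by (intro pos_def_congruence pos_def_mat_powr S0 S1)
  have "det (geodesic S0 S1 t) =
      det S0 powr (1/2) * (det S0 powr (-1/2) * det S1 * det S0 powr (-1/2)) powr t * det S0 powr (1/2)"
    by (simp only: geodesic_def det_mul det_mat_powr[OF mid] det_mat_powr[OF S0])
  also have "\<dots> = (det S0 powr (1/2) * det S0 powr (-t/2) * det S0 powr (-t/2) * det S0 powr (1/2)) * det S1 powr t"
    using pos by (simp add: powr_mult powr_powr)
  also have "\<dots> = det S0 powr (1 - t) * det S1 powr t"
    by (simp add: powr_add[symmetric])
  finally show ?thesis .
qed

lemma scaleR_triple_matrix_product:
  fixes X Y Z :: "real^'n^'n"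
  shows "(a *\<^sub>R X) ** (b *\<^sub>R Y) ** (c *\<^sub>R Z) = (a * b * c) *\<^sub>R (X ** Y ** Z)"
  by (simp add: scalar_matrix_assoc[symmetric] matrix_scalar_ac mult_ac)

text \<open>The middle factor is scaled by \<open>b / a\<close> before its power is taken and the outer factors by
  \<open>a\<close> in total, which gives \<open>a (b / a)\<^sup>t\<close>.\<close>

lemma geodesic_scaleR:
  assumes S0: "pos_def_mat S0" and S1: "pos_def_mat S1" and a: "0 < a" and b: "0 < b"
  shows "geodesic (a *\<^sub>R S0) (b *\<^sub>R S1) t = (a powr (1 - t) * b powr t) *\<^sub>R geodesic S0 S1 t"
proof -
  define N where "N = mat_powr S0 (-1/2) ** S1 ** mat_powr S0 (-1/2)"
  have N: "pos_def_mat N" unfolding N_def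
    by (intro pos_def_congruence pos_def_mat_powr S0 S1)
  have ha: "a powr (-1/2) * a powr (-1/2) = 1 / a" "a powr (1/2) * a powr (1/2) = a"
    using a by (simp_all add: powr_add[symmetric] powr_minus_divide)
  have mid: "mat_powr (a *\<^sub>R S0) (-1/2) ** (b *\<^sub>R S1) ** mat_powr (a *\<^sub>R S0) (-1/2) = (b / a) *\<^sub>R N"
  proof -
    have "a powr (-1/2) * b * a powr (-1/2) = b / a"
      using ha(1) by (simp add: mult_ac)
    then show ?thesis
      by (simp only: mat_powr_scaleR[OF S0 a] scaleR_triple_matrix_product N_def)
  qed
  have "geodesic (a *\<^sub>R S0) (b *\<^sub>R S1) t =
      (a powr (1/2) * (b / a) powr t * a powr (1/2)) *\<^sub>R geodesic S0 S1 t"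
    unfolding geodesic_def mid N_def[symmetric]
    by (simp only: mat_powr_scaleR[OF S0 a] mat_powr_scaleR[OF N divide_pos_pos[OF b a]]
      scaleR_triple_matrix_product)
  also have "a powr (1/2) * (b / a) powr t * a powr (1/2) = a * (b / a) powr t"
    using ha(2) by (simp add: mult_ac)
  also have "\<dots> = a powr (1 - t) * b powr t"
    using a b by (simp add: powr_diff powr_divide)
  finally show ?thesis .
qed

lemma pos_def_shape_matrix:
  assumes "pos_def_mat S"
  shows "pos_def_mat (shape_matrix S)"
  unfolding shape_matrix_def using pos_def_det_pos[OF assms] by (intro pos_def_scaleR assms) simp

text \<open>With \<open>a = (det S0) powr (-1/q)\<close> and \<open>b = (det S1) powr (-1/q)\<close>, the scaling factor of
  \<open>geodesic_scaleR\<close> is the normalising factor given by \<open>det_geodesic\<close>.\<close>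

lemma shape_matrix_geodesic:
  assumes S0: "pos_def_mat S0" and S1: "pos_def_mat S1"
  shows "shape_matrix (geodesic S0 S1 t) = geodesic (shape_matrix S0) (shape_matrix S1) t"
proof -
  have pos: "0 < det S0" "0 < det S1" using S0 S1 by (auto intro: pos_def_det_pos)
  then show ?thesis
    unfolding shape_matrix_def
    by (subst geodesic_scaleR[OF S0 S1])
      (simp_all add: det_geodesic[OF S0 S1] powr_mult powr_powr powr_divide mult_ac)
qed

section \<open>Normalisation and the matrix exponential\<close>

text \<open>For fixed \<open>Q\<close> the map \<open>d \<mapsto> Q diag(d) Q\<^sup>T\<close> is linear, hence continuous, so it carries the
  coordinatewise exponential series to the matrix exponential series.\<close>

lemma mat_exp_spectral:
  assumes Q: "orthogonal_matrix Q"
  shows "mat_exp (spectral Q d) = spectral Q (\<chi> i. exp (d $ i))"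
proof -
  have pow: "((\<lambda>B. spectral Q d ** B) ^^ k) (mat 1) = spectral Q (\<chi> i. d $ i ^ k)" for k
    by (induction k) (simp_all add: spectral_one spectral_mult Q)
  have "(\<lambda>k. (1 / fact k) *\<^sub>R (\<chi> i. d $ i ^ k)) sums (\<chi> i. exp (d $ i))"
    unfolding sums_def
    by (rule vec_tendstoI)
      (use exp_converges[where 'a = real] in \<open>simp add: sums_def divide_inverse mult_ac\<close>)
  then have "(\<lambda>k. spectral Q ((1 / fact k) *\<^sub>R (\<chi> i. d $ i ^ k))) sums spectral Q (\<chi> i. exp (d $ i))"
    by (rule bounded_linear.sums[OF linear_conv_bounded_linear[THEN iffD1, OF linear_spectral]])
  then show ?thesis
    unfolding mat_exp_def pow spectral_scaleR by (simp add: sums_iff)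
qed

text \<open>Subtracting \<open>c I\<close> shifts all eigenvalues by \<open>c\<close> and so divides the exponential by
  \<open>exp c\<close>. For \<open>c = trace A / q\<close> this is the \<open>q\<close>-th root of
  \<open>det (exp A) = exp (trace A)\<close>.\<close>

lemma shape_matrix_mat_exp:
  fixes A :: "real^'n^'n"
  assumes "transpose A = A"
  shows "shape_matrix (mat_exp A) = mat_exp (A - (trace A / real CARD('n)) *\<^sub>R mat 1)"
proof -
  obtain Q d where Q: "orthogonal_matrix Q" and A: "A = spectral Q d"
    using symmetric_spectral_decomposition[OF assms] .
  define c where "c = trace A / real CARD('n)"
  have "det (mat_exp A) = exp (trace A)"
    by (simp add: A mat_exp_spectral det_spectral trace_spectral Q exp_sum)
  then have "1 / det (mat_exp A) powr (1 / real CARD('n)) = exp (- c)"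
    by (simp add: c_def powr_def exp_minus divide_inverse)
  then have "shape_matrix (mat_exp A) = spectral Q (exp (- c) *\<^sub>R (\<chi> i. exp (d $ i)))"
    by (simp add: shape_matrix_def A mat_exp_spectral Q spectral_scaleR)
  also have "exp (- c) *\<^sub>R (\<chi> i. exp (d $ i)) = (\<chi> i. exp ((d - c *\<^sub>R (\<chi> i. 1)) $ i))"
    by (simp add: vec_eq_iff exp_diff exp_minus divide_inverse mult.commute)
  also have "spectral Q \<dots> = mat_exp (spectral Q (d - c *\<^sub>R (\<chi> i. 1)))"
    by (simp add: mat_exp_spectral Q)
  also have "spectral Q (d - c *\<^sub>R (\<chi> i. 1)) = A - c *\<^sub>R mat 1"
    by (simp add: A linear_diff[OF linear_spectral] spectral_scaleR spectral_one Q)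
  finally show ?thesis by (simp add: c_def)
qed

lemma convex_on_compose_linear_map:
  fixes L :: "'a::real_vector \<Rightarrow> 'b::real_vector"
  assumes g: "convex_on T g" and L: "linear L" and S: "convex S" "L ` S \<subseteq> T"
    and f: "\<And>x. x \<in> S \<Longrightarrow> f x = g (L x)"
  shows "convex_on S f"
proof -
  have "f (u *\<^sub>R x + v *\<^sub>R y) \<le> u * f x + v * f y"
    if "x \<in> S" "y \<in> S" "0 \<le> u" "0 \<le> v" "u + v = 1" for x y u v
  proof -
    have "u *\<^sub>R x + v *\<^sub>R y \<in> S" using S(1) that by (rule convexD)
    then have "f (u *\<^sub>R x + v *\<^sub>R y) = g (u *\<^sub>R L x + v *\<^sub>R L y)"
      by (simp add: f linear_add[OF L] linear_scale[OF L])
    also have "\<dots> \<le> u * g (L x) + v * g (L y)"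
      proof -
        have "L x \<in> T" "L y \<in> T" using S(2) that by auto
        then show ?thesis using g that unfolding convex_on_def by blast
      qed
    finally show ?thesis using that by (simp add: f)
  qed
  then show ?thesis using S(1) by (simp add: convex_on_def)
qed

theorem theorem4p1:
  fixes P :: "real^'n^'n \<Rightarrow> real"
  assumes nonneg: "\<And>S. pos_def_mat S \<Longrightarrow> 0 \<le> P S"
  shows "(g_convex P \<longrightarrow> g_convex (shape_version P)) \<and>
         (convex_in_log P \<longrightarrow> convex_in_log (shape_version P))"
proof (intro conjI impI)
  assume "g_convex P"
  then show "g_convex (shape_version P)"
    by (simp add: g_convex_def shape_version_def shape_matrix_geodesic pos_def_shape_matrix)
next
  assume cvx: "convex_in_log P"
  let ?Sym = "{A :: real^'n^'n. transpose A = A}"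
  define L where "L = (\<lambda>A :: real^'n^'n. A - (trace A / real CARD('n)) *\<^sub>R mat 1)"
  have "linear L"
  proof (rule linearI)
    fix A B :: "real^'n^'n" and c :: real
    show "L (A + B) = L A + L B"
      by (simp add: L_def trace_add add_divide_distrib scaleR_add_left)
    have "trace (c *\<^sub>R A) = c * trace A"
      by (simp add: trace_def sum_distrib_left)
    then show "L (c *\<^sub>R A) = c *\<^sub>R L A"
      by (simp add: L_def scaleR_diff_right)
  qed
  moreover have tr: "transpose (A + B) = transpose A + transpose B" for A B :: "real^'n^'n"
    by (simp add: transpose_def vec_eq_iff)
  then have "convex ?Sym"
    by (auto simp: convex_def transpose_scalar)
  moreover have "L ` ?Sym \<subseteq> ?Sym"
    by (auto simp: L_def transpose_def vec_eq_iff mat_def)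
  moreover have "shape_version P (mat_exp A) = P (mat_exp (L A))" if "A \<in> ?Sym" for A
    using that by (simp add: shape_version_def shape_matrix_mat_exp L_def)
  ultimately show "convex_in_log (shape_version P)"
    using cvx convex_on_compose_linear_map[of ?Sym "\<lambda>A. P (mat_exp A)" L ?Sym
      "\<lambda>A. shape_version P (mat_exp A)"]
    unfolding convex_in_log_def by blast
qed

end
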